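(* Let $\alpha\in\mathbb{R}$. If $f$ is cyclic in $\mathfrak{D}_\alpha$, then for every fixed $z_2\in\mathbb{D}$ the slice $f_{z_2}(z_1)=f(z_1,z_2)$, $z_1\in\mathbb{D}$, is cyclic in $D_\alpha$, and for every fixed $z_1\in\mathbb{D}$ the slice $f_{z_1}(z_2)=f(z_1,z_2)$, $z_2\in\mathbb{D}$, is cyclic in $D_\alpha$.
   Context: For $\alpha\in\mathbb{R}$, $D_\alpha$ is the Hilbert space of analytic functions $g(z)=\sum_{k\ge0}a_kz^k$ on the unit disk $\mathbb{D}$ with $\|g\|_{D_\alpha}^2=\sum_{k\ge0}(k+1)^\alpha|a_k|^2<\infty$, and $\mathfrak{D}_\alpha$ is the Hilbert space of holomorphic functions $f(z_1,z_2)=\sum_{k,l\ge0}a_{k,l}z_1^kz_2^l$ on the bidisk $\mathbb{D}^2$ with $\|f\|_\alpha^2=\sum_{k,l\ge0}(k+1)^\alpha(l+1)^\alpha|a_{k,l}|^2<\infty$. A function $f\in\mathfrak{D}_\alpha$ is cyclic if the closed linear span of $\{z_1^kz_2^lf: k,l\ge0\}$ is all of $\mathfrak{D}_\alpha$; equivalently, there are polynomials $p_n$ in two variables with $\|p_nf-1\|_\alpha\to0$. Likewise $g\in D_\alpha$ is cyclic if the closed linear span of $\{z^kg:k\ge0\}$ is $D_\alpha$; equivalently, there are one-variable polynomials $p_n$ with $\|p_ng-1\|_{D_\alpha}\to0$. *)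

theory Defs
  imports "HOL-Complex_Analysis.Complex_Analysis" "HOL-Library.Function_Algebras"
begin

text \<open>
  Functions on the disk and on the bidisk are represented by total functions on
  \<open>complex\<close> and \<open>complex \<times> complex\<close>. Their values off the (bi)disk play no role: membership in
  the spaces, the norms, and hence all closures below depend only on the values inside.
\<close>

abbreviation unit_disk :: "complex set" where
  "unit_disk \<equiv> ball 0 1"

text \<open>Pointwise complex vector space structure; it provides \<open>cfun.span\<close>.\<close>

interpretation cfun: vector_space "\<lambda>(c::complex) (g::'a \<Rightarrow> complex) x. c * g x"
  by unfold_locales (auto simp: fun_eq_iff algebra_simps)

definition closed_span :: "('a \<Rightarrow> complex) set \<Rightarrow> (('a \<Rightarrow> complex) \<Rightarrow> real) \<Rightarrow>
    ('a \<Rightarrow> complex) set \<Rightarrow> ('a \<Rightarrow> complex) set" where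
  "closed_span X nrm B = {g \<in> X. \<forall>\<epsilon>>0. \<exists>h\<in>cfun.span B. nrm (\<lambda>x. g x - h x) < \<epsilon>}"


subsection \<open>The space on the disk\<close>

definition D_space :: "real \<Rightarrow> (complex \<Rightarrow> complex) set" where
  "D_space \<alpha> = {g. g holomorphic_on unit_disk \<and>
     summable (\<lambda>k. (real k + 1) powr \<alpha> * (cmod (fps_nth (fps_expansion g 0) k))\<^sup>2)}"

definition D_norm :: "real \<Rightarrow> (complex \<Rightarrow> complex) \<Rightarrow> real" where
  "D_norm \<alpha> g = sqrt (\<Sum>k. (real k + 1) powr \<alpha> * (cmod (fps_nth (fps_expansion g 0) k))\<^sup>2)"

definition D_cyclic :: "real \<Rightarrow> (complex \<Rightarrow> complex) \<Rightarrow> bool" where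
  "D_cyclic \<alpha> g \<longleftrightarrow> g \<in> D_space \<alpha> \<and>
     closed_span (D_space \<alpha>) (D_norm \<alpha>) (range (\<lambda>k z. z ^ k * g z)) = D_space \<alpha>"


subsection \<open>The space on the bidisk\<close>

text \<open>
  Holomorphy on the bidisk is expressed by (unconditional) convergence of a double power series
  on the whole bidisk.
\<close>

definition bidisk_expansion :: "(complex \<times> complex \<Rightarrow> complex) \<Rightarrow> (nat \<Rightarrow> nat \<Rightarrow> complex) \<Rightarrow> bool" where
  "bidisk_expansion f a \<longleftrightarrow> (\<forall>z1\<in>unit_disk. \<forall>z2\<in>unit_disk.
     ((\<lambda>(k, l). a k l * z1 ^ k * z2 ^ l) has_sum f (z1, z2)) UNIV)"

definition holomorphic_bidisk :: "(complex \<times> complex \<Rightarrow> complex) \<Rightarrow> bool" where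
  "holomorphic_bidisk f \<longleftrightarrow> (\<exists>a. bidisk_expansion f a)"

definition bicoeff :: "(complex \<times> complex \<Rightarrow> complex) \<Rightarrow> nat \<Rightarrow> nat \<Rightarrow> complex" where
  "bicoeff f = (THE a. bidisk_expansion f a)"

lemma powser_disk_eq_0:
  fixes c :: "nat \<Rightarrow> complex"
  assumes "\<And>z. z \<in> unit_disk \<Longrightarrow> (\<lambda>k. c k * z ^ k) sums 0"
  shows "c k = 0"
proof (rule ccontr)
  assume nz: "c k \<noteq> 0"
  show False
  proof (cases "k = 0")
    case True
    with assms[of 0] nz show False by simp
  next
    case False
    then have "k > 0" by simp
    have sm: "\<And>w. norm (w - 0) < 1 \<Longrightarrow> (\<lambda>n. c n * (w - 0) ^ n) sums 0"
      using assms by simp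
    show False
    proof (rule powser_0_nonzero[of 1 0 c "\<lambda>_. 0" k, OF zero_less_one sm refl nz \<open>k > 0\<close>])
      fix s :: real
      assume s: "0 < s" "\<And>z::complex. z \<in> cball 0 s - {0} \<Longrightarrow> (0::complex) \<noteq> 0"
      from s(1) have "complex_of_real s \<in> cball 0 s - {0}" by simp
      from s(2)[OF this] show False by simp
    qed
  qed
qed

lemma bidisk_expansion_unique:
  assumes "bidisk_expansion f a" "bidisk_expansion f b"
  shows "a = b"
proof -
  define d where "d = (\<lambda>k l. a k l - b k l)"
  have d: "((\<lambda>(k, l). d k l * z1 ^ k * z2 ^ l) has_sum 0) (UNIV \<times> UNIV)"
    if z: "z1 \<in> unit_disk" "z2 \<in> unit_disk" for z1 z2
  proof -
    have "((\<lambda>p. (case p of (k, l) \<Rightarrow> a k l * z1 ^ k * z2 ^ l) +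
        - (case p of (k, l) \<Rightarrow> b k l * z1 ^ k * z2 ^ l)) has_sum (f (z1, z2) + - f (z1, z2))) UNIV"
      using assms z unfolding bidisk_expansion_def
      by (intro has_sum_add) (auto simp: has_sum_uminus)
    then show ?thesis
      by (simp add: d_def case_prod_unfold algebra_simps)
  qed
  have "d k l = 0" for k l
  proof (rule powser_disk_eq_0[of "d k"])
    fix z2 :: complex assume z2: "z2 \<in> unit_disk"
    define S where "S = (\<lambda>k. \<Sum>\<^sub>\<infinity>l. d k l * z2 ^ l)"
    have inner: "(\<lambda>l. d k l * z2 ^ l) summable_on UNIV" for k
    proof -
      have half: "(1/2 :: complex) \<in> unit_disk" by simp
      have "(\<lambda>(k, l). d k l * (1/2) ^ k * z2 ^ l) summable_on (UNIV \<times> UNIV)"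
        using d[OF half z2] by (auto simp: summable_on_def)
      then have "(\<lambda>l. d k l * (1/2) ^ k * z2 ^ l) summable_on UNIV"
        using summable_on_SigmaD1[of "\<lambda>k l. d k l * (1/2) ^ k * z2 ^ l" UNIV "\<lambda>_. UNIV" k] by simp
      then have "(\<lambda>l. 2 ^ k * (d k l * (1/2) ^ k * z2 ^ l)) summable_on UNIV"
        by (rule summable_on_cmult_right)
      then show ?thesis by (simp add: field_simps)
    qed
    have "S k = 0"
    proof (rule powser_disk_eq_0[of S])
      fix z1 :: complex assume z1: "z1 \<in> unit_disk"
      have "((\<lambda>l. d k l * z1 ^ k * z2 ^ l) has_sum (S k * z1 ^ k)) UNIV" for k
      proof -
        have "((\<lambda>l. d k l * z2 ^ l) has_sum S k) UNIV"
          using inner by (simp add: S_def)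
        then have "((\<lambda>l. d k l * z2 ^ l * z1 ^ k) has_sum (S k * z1 ^ k)) UNIV"
          by (rule has_sum_cmult_left)
        then show ?thesis by (simp add: mult_ac)
      qed
      then have "((\<lambda>k. S k * z1 ^ k) has_sum 0) UNIV"
        using has_sum_SigmaD[OF d[OF z1 z2], of "\<lambda>k. S k * z1 ^ k"] by simp
      then show "(\<lambda>k. S k * z1 ^ k) sums 0" by (rule has_sum_imp_sums)
    qed
    with inner[of k] have "((\<lambda>l. d k l * z2 ^ l) has_sum 0) UNIV"
      by (metis S_def has_sum_infsum)
    then show "(\<lambda>l. d k l * z2 ^ l) sums 0" by (rule has_sum_imp_sums)
  qed
  then show ?thesis by (auto simp: d_def fun_eq_iff)
qed

lemma bicoeff_eqI: "bidisk_expansion f a \<Longrightarrow> bicoeff f = a"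
  unfolding bicoeff_def using bidisk_expansion_unique by blast

definition bidisk_space :: "real \<Rightarrow> (complex \<times> complex \<Rightarrow> complex) set" where
  "bidisk_space \<alpha> = {f. holomorphic_bidisk f \<and>
     (\<lambda>(k, l). (real k + 1) powr \<alpha> * (real l + 1) powr \<alpha> * (cmod (bicoeff f k l))\<^sup>2)
       summable_on UNIV}"

definition bidisk_norm :: "real \<Rightarrow> (complex \<times> complex \<Rightarrow> complex) \<Rightarrow> real" where
  "bidisk_norm \<alpha> f = sqrt (\<Sum>\<^sub>\<infinity>(k, l).
     (real k + 1) powr \<alpha> * (real l + 1) powr \<alpha> * (cmod (bicoeff f k l))\<^sup>2)"

definition bidisk_cyclic :: "real \<Rightarrow> (complex \<times> complex \<Rightarrow> complex) \<Rightarrow> bool" where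
  "bidisk_cyclic \<alpha> f \<longleftrightarrow> f \<in> bidisk_space \<alpha> \<and>
     closed_span (bidisk_space \<alpha>) (bidisk_norm \<alpha>)
       (range (\<lambda>(k, l) (z1, z2). z1 ^ k * z2 ^ l * f (z1, z2))) = bidisk_space \<alpha>"

end

(* Evaluating the second variable at a point w of the disk is a bounded map of the bidisk space
   onto the disk space: the k-th coefficient of the slice is the sum over l of a k l * w^l, so by
   Cauchy-Schwarz its square is at most (\<Sum>l. (l+1) powr \<alpha> * |a k l|^2) times the finite constant
   (\<Sum>l. (l+1) powr (-\<alpha>) * |w|^(2l)). The map sends z1^k * z2^l * f to w^l * z1^k * f(z1, w), and
   every g on the disk is the slice of (z1, z2) \<mapsto> g z1, so approximations by multiples of f
   descend to approximations by multiples of the slice. *)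

theory Submission
  imports Defs "HOL-Real_Asymp.Real_Asymp"
begin

section \<open>Weight estimates and power series in one variable\<close>

text \<open>The quotient of k + m + 1 by k + 1 lies between 1 and m + 1, so its power is controlled
  uniformly in k whatever the sign of \<alpha>; hence the absolute value in the exponent. This is
  what makes multiplication by a monomial preserve the weighted spaces.\<close>

lemma powr_index_shift_le:
  "(real (k + m) + 1) powr \<alpha> \<le> (real m + 1) powr \<bar>\<alpha>\<bar> * (real k + 1) powr \<alpha>"
proof -
  define r where "r = (real (k + m) + 1) / (real k + 1)"
  have r1: "1 \<le> r" by (simp add: r_def)
  have "real (k + m) + 1 \<le> (real m + 1) * (real k + 1)"
    by (simp add: algebra_simps)
  then have rm: "r \<le> real m + 1" by (simp add: r_def field_simps)
  have "r powr \<alpha> \<le> r powr \<bar>\<alpha>\<bar>" using r1 by (intro powr_mono) auto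
  also have "\<dots> \<le> (real m + 1) powr \<bar>\<alpha>\<bar>" using r1 rm by (intro powr_mono2) auto
  finally have "r powr \<alpha> * (real k + 1) powr \<alpha> \<le> (real m + 1) powr \<bar>\<alpha>\<bar> * (real k + 1) powr \<alpha>"
    by (rule mult_right_mono) simp
  moreover have "r powr \<alpha> * (real k + 1) powr \<alpha> = (r * (real k + 1)) powr \<alpha>"
    using r1 by (simp add: powr_mult)
  moreover have "r * (real k + 1) = real (k + m) + 1"
    by (simp add: r_def)
  ultimately show ?thesis by simp
qed

lemma summable_powr_mult_power:
  assumes "0 \<le> r" "r < 1"
  shows "summable (\<lambda>l. (real l + 1) powr \<beta> * r ^ l)"
\<comment> \<open>Only the term l = 0 survives when r = 0; the asymptotic comparison in the other
  case uses 0 < r.\<close>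
proof (cases "r = 0")
  case True
  then show ?thesis
    by (auto intro: summable_finite[of "{0}"])
next
  case False
  \<comment> \<open>The midpoint of r and 1: the gap between r and s absorbs the polynomial factor,
    while s < 1 keeps the geometric series convergent.\<close>
  define s where "s = (r + 1) / 2"
  have rs: "0 < r" "r < s" "0 < s" "s < 1" using assms False by (auto simp: s_def)
  have "(\<lambda>l. (real l + 1) powr \<beta> * r ^ l) \<in> O(\<lambda>l. s ^ l)"
    using rs by real_asymp
  then show ?thesis
    by (rule summable_comparison_test_bigo[rotated]) (use rs in \<open>simp add: summable_geometric\<close>)
qed

text \<open>Two power series with the same sum on the whole disk differ by a series summing to 0
  there, so their coefficients agree. Slices arise as explicit series, and this identifies the
  coefficients entering \<open>D_norm\<close>.\<close>

lemma sums_disk_imp_fps_expansion: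
  assumes "\<And>z. z \<in> unit_disk \<Longrightarrow> (\<lambda>k. b k * z ^ k) sums g z"
  shows "g holomorphic_on unit_disk" and "fps_nth (fps_expansion g 0) = b"
proof -
  show hol: "g holomorphic_on unit_disk"
    by (rule power_series_holomorphic[where a = b]) (use assms in auto)
  show "fps_nth (fps_expansion g 0) = b"
  proof
    fix k
    have "fps_nth (fps_expansion g 0) k - b k = 0"
    proof (rule powser_disk_eq_0)
      fix z :: complex assume z: "z \<in> unit_disk"
      have "(\<lambda>k. fps_nth (fps_expansion g 0) k * z ^ k) sums g z"
        using holomorphic_power_series[OF hol z] by (simp add: fps_expansion_def)
      from sums_diff[OF this assms[OF z]]
      show "(\<lambda>k. (fps_nth (fps_expansion g 0) k - b k) * z ^ k) sums 0"
        by (simp add: algebra_simps)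
    qed
    then show "fps_nth (fps_expansion g 0) k = b k" by simp
  qed
qed

text \<open>Bidisk expansions are unconditional sums, so viewing g as a function of two variables
  requires absolute convergence of its Taylor series, not just convergence of partial sums.\<close>

lemma holomorphic_disk_has_sum:
  assumes "g holomorphic_on unit_disk" and z: "z \<in> unit_disk"
  shows "((\<lambda>k. fps_nth (fps_expansion g 0) k * z ^ k) has_sum g z) UNIV"
proof (rule norm_summable_imp_has_sum)
  have sums: "(\<lambda>k. fps_nth (fps_expansion g 0) k * z ^ k) sums g z" if "z \<in> unit_disk" for z
    using holomorphic_power_series[OF assms(1) that] by (simp add: fps_expansion_def)
  show "(\<lambda>k. fps_nth (fps_expansion g 0) k * z ^ k) sums g z" by (rule sums[OF z])
  \<comment> \<open>Convergence at a point of strictly larger modulus forces absolute convergence at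
    z.\<close>
  obtain r where r: "cmod z < r" "r < 1" using z dense[of "cmod z" 1] by auto
  have "summable (\<lambda>k. fps_nth (fps_expansion g 0) k * (of_real r) ^ k)"
    using sums[of "of_real r"] r le_less_trans[OF norm_ge_zero r(1)]
    by (intro sums_summable[where l = "g (of_real r)"]) auto
  then show "summable (\<lambda>k. norm (fps_nth (fps_expansion g 0) k * z ^ k))"
    by (rule powser_insidea) (use r in \<open>simp add: le_less_trans[OF norm_ge_zero]\<close>)
qed

section \<open>Closure properties of the bidisk space\<close>

text \<open>By uniqueness of expansions, the description \<open>bicoeff\<close> may be replaced by
  any coefficient array exhibited by hand; the membership proofs below just supply such an
  array.\<close>

lemma bidisk_spaceI:
  assumes "bidisk_expansion u a"
    and "(\<lambda>(k, l). (real k + 1) powr \<alpha> * (real l + 1) powr \<alpha> * (cmod (a k l))\<^sup>2) summable_on UNIV"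
  shows "u \<in> bidisk_space \<alpha>"
  using assms bicoeff_eqI[OF assms(1)] by (auto simp: bidisk_space_def holomorphic_bidisk_def)

lemma bidisk_spaceE:
  assumes "u \<in> bidisk_space \<alpha>"
  obtains a where "bidisk_expansion u a"
    and "(\<lambda>(k, l). (real k + 1) powr \<alpha> * (real l + 1) powr \<alpha> * (cmod (a k l))\<^sup>2) summable_on UNIV"
    and "bidisk_norm \<alpha> u = sqrt (\<Sum>\<^sub>\<infinity>(k, l). (real k + 1) powr \<alpha> * (real l + 1) powr \<alpha> * (cmod (a k l))\<^sup>2)"
  using assms bicoeff_eqI that
  unfolding bidisk_space_def holomorphic_bidisk_def bidisk_norm_def by blast

lemma bidisk_space_add:
  assumes "u \<in> bidisk_space \<alpha>" "v \<in> bidisk_space \<alpha>"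
  shows "u + v \<in> bidisk_space \<alpha>"
proof -
  let ?w = "\<lambda>k l. (real k + 1) powr \<alpha> * (real l + 1) powr \<alpha>"
  obtain a where a: "bidisk_expansion u a" "(\<lambda>(k, l). ?w k l * (cmod (a k l))\<^sup>2) summable_on UNIV"
    using assms(1) by (rule bidisk_spaceE)
  obtain b where b: "bidisk_expansion v b" "(\<lambda>(k, l). ?w k l * (cmod (b k l))\<^sup>2) summable_on UNIV"
    using assms(2) by (rule bidisk_spaceE)
  show ?thesis
  proof (rule bidisk_spaceI)
    show "bidisk_expansion (u + v) (\<lambda>k l. a k l + b k l)"
      unfolding bidisk_expansion_def
    proof (intro ballI)
      fix z1 z2 :: complex assume z: "z1 \<in> unit_disk" "z2 \<in> unit_disk"
      have "((\<lambda>p. (case p of (k, l) \<Rightarrow> a k l * z1 ^ k * z2 ^ l) +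
          (case p of (k, l) \<Rightarrow> b k l * z1 ^ k * z2 ^ l)) has_sum (u (z1, z2) + v (z1, z2))) UNIV"
        using a(1) b(1) z unfolding bidisk_expansion_def by (intro has_sum_add) auto
      then show "((\<lambda>(k, l). (a k l + b k l) * z1 ^ k * z2 ^ l) has_sum (u + v) (z1, z2)) UNIV"
        by (simp add: case_prod_unfold algebra_simps)
    qed
    \<comment> \<open>The dominating series comes from |x + y|^2 \<le> 2|x|^2 + 2|y|^2.\<close>
    have "(\<lambda>p. 2 * (case p of (k, l) \<Rightarrow> ?w k l * (cmod (a k l))\<^sup>2) +
        2 * (case p of (k, l) \<Rightarrow> ?w k l * (cmod (b k l))\<^sup>2)) summable_on UNIV"
      using a(2) b(2) by (intro summable_on_add summable_on_cmult_right)
    then show "(\<lambda>(k, l). ?w k l * (cmod (a k l + b k l))\<^sup>2) summable_on UNIV"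
    proof (rule summable_on_comparison_test)
      have "?w k l * (cmod (x + y))\<^sup>2 \<le> 2 * (?w k l * (cmod x)\<^sup>2) + 2 * (?w k l * (cmod y)\<^sup>2)"
        for k l :: nat and x y
      proof -
        have "(cmod (x + y))\<^sup>2 \<le> (cmod x + cmod y)\<^sup>2"
          by (intro power_mono norm_triangle_ineq) auto
        also have "\<dots> \<le> 2 * (cmod x)\<^sup>2 + 2 * (cmod y)\<^sup>2"
          using sum_squares_bound[of "cmod x" "cmod y"] by (simp add: power2_sum)
        finally have "?w k l * (cmod (x + y))\<^sup>2 \<le> ?w k l * (2 * (cmod x)\<^sup>2 + 2 * (cmod y)\<^sup>2)"
          by (rule mult_left_mono) simp
        then show ?thesis by (simp add: algebra_simps)
      qed
      then show "(case p of (k, l) \<Rightarrow> ?w k l * (cmod (a k l + b k l))\<^sup>2) \<le>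
          2 * (case p of (k, l) \<Rightarrow> ?w k l * (cmod (a k l))\<^sup>2) +
          2 * (case p of (k, l) \<Rightarrow> ?w k l * (cmod (b k l))\<^sup>2)" for p
        by (cases p) simp
    qed auto
  qed
qed

lemma bidisk_space_scale:
  assumes "u \<in> bidisk_space \<alpha>"
  shows "(\<lambda>x. c * u x) \<in> bidisk_space \<alpha>"
proof -
  let ?w = "\<lambda>k l. (real k + 1) powr \<alpha> * (real l + 1) powr \<alpha>"
  obtain a where a: "bidisk_expansion u a" "(\<lambda>(k, l). ?w k l * (cmod (a k l))\<^sup>2) summable_on UNIV"
    using assms by (rule bidisk_spaceE)
  show ?thesis
  proof (rule bidisk_spaceI)
    show "bidisk_expansion (\<lambda>x. c * u x) (\<lambda>k l. c * a k l)"
      unfolding bidisk_expansion_def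
    proof (intro ballI)
      fix z1 z2 :: complex assume z: "z1 \<in> unit_disk" "z2 \<in> unit_disk"
      have "((\<lambda>p. c * (case p of (k, l) \<Rightarrow> a k l * z1 ^ k * z2 ^ l)) has_sum (c * u (z1, z2))) UNIV"
        using a(1) z unfolding bidisk_expansion_def by (intro has_sum_cmult_right) auto
      then show "((\<lambda>(k, l). c * a k l * z1 ^ k * z2 ^ l) has_sum c * u (z1, z2)) UNIV"
        by (simp add: case_prod_unfold mult.assoc)
    qed
    have "(\<lambda>p. (cmod c)\<^sup>2 * (case p of (k, l) \<Rightarrow> ?w k l * (cmod (a k l))\<^sup>2)) summable_on UNIV"
      using a(2) by (rule summable_on_cmult_right)
    then show "(\<lambda>(k, l). ?w k l * (cmod (c * a k l))\<^sup>2) summable_on UNIV"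
      by (simp add: case_prod_unfold norm_mult power_mult_distrib mult_ac)
  qed
qed

text \<open>The coefficients are transported along the injection \<open>h\<close>, and each of the
  two weights grows by a factor bounded independently of k and l.\<close>

lemma bidisk_space_mult_monomial:
  assumes "u \<in> bidisk_space \<alpha>"
  shows "(\<lambda>(z1, z2). z1 ^ m * z2 ^ n * u (z1, z2)) \<in> bidisk_space \<alpha>"
proof -
  let ?w = "\<lambda>k l. (real k + 1) powr \<alpha> * (real l + 1) powr \<alpha>"
  obtain a where a: "bidisk_expansion u a" "(\<lambda>(k, l). ?w k l * (cmod (a k l))\<^sup>2) summable_on UNIV"
    using assms by (rule bidisk_spaceE)
  define h where "h = (\<lambda>(k, l). (k + m, l + n))"
  have inj: "inj h" by (auto simp: h_def inj_on_def)
  \<comment> \<open>The guard makes \<open>b\<close> vanish off the range of \<open>h\<close>;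
    truncated subtraction alone would repeat entries of \<open>a\<close> there.\<close>
  define b where "b = (\<lambda>k l. if m \<le> k \<and> n \<le> l then a (k - m) (l - n) else 0)"
  have b0: "b (fst p) (snd p) = 0" if "p \<notin> range h" for p
  proof (rule ccontr)
    assume "b (fst p) (snd p) \<noteq> 0"
    then have "p = h (fst p - m, snd p - n)" by (auto simp: b_def h_def split: if_splits)
    with that show False by blast
  qed
  show ?thesis
  proof (rule bidisk_spaceI)
    show "bidisk_expansion (\<lambda>(z1, z2). z1 ^ m * z2 ^ n * u (z1, z2)) b"
      unfolding bidisk_expansion_def
    proof (intro ballI)
      fix z1 z2 :: complex assume z: "z1 \<in> unit_disk" "z2 \<in> unit_disk"
      let ?f = "\<lambda>(k, l). b k l * z1 ^ k * z2 ^ l"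
      have "((\<lambda>p. z1 ^ m * z2 ^ n * (case p of (k, l) \<Rightarrow> a k l * z1 ^ k * z2 ^ l))
          has_sum (z1 ^ m * z2 ^ n * u (z1, z2))) UNIV"
        using a(1) z unfolding bidisk_expansion_def by (intro has_sum_cmult_right) auto
      also have "(\<lambda>p. z1 ^ m * z2 ^ n * (case p of (k, l) \<Rightarrow> a k l * z1 ^ k * z2 ^ l)) = ?f \<circ> h"
        by (auto simp: fun_eq_iff h_def b_def power_add)
      finally have "(?f has_sum (z1 ^ m * z2 ^ n * u (z1, z2))) (range h)"
        by (simp only: has_sum_reindex[OF inj])
      then have "(?f has_sum (z1 ^ m * z2 ^ n * u (z1, z2))) UNIV"
        by (subst has_sum_cong_neutral[where T = "range h"]) (auto simp: case_prod_unfold b0)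
      then show "(?f has_sum (\<lambda>(z1, z2). z1 ^ m * z2 ^ n * u (z1, z2)) (z1, z2)) UNIV"
        by simp
    qed
    let ?g = "\<lambda>(k, l). ?w k l * (cmod (b k l))\<^sup>2"
    \<comment> \<open>One factor from \<open>powr_index_shift_le\<close> for each variable.\<close>
    let ?K = "(real m + 1) powr \<bar>\<alpha>\<bar> * (real n + 1) powr \<bar>\<alpha>\<bar>"
    have "(\<lambda>p. ?K * (case p of (k, l) \<Rightarrow> ?w k l * (cmod (a k l))\<^sup>2)) summable_on UNIV"
      using a(2) by (rule summable_on_cmult_right)
    then have "(?g \<circ> h) summable_on UNIV"
    proof (rule summable_on_comparison_test)
      fix p :: "nat \<times> nat"
      obtain k l where p: "p = (k, l)" by (cases p)
      have "?w (k + m) (l + n) \<le>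
          ((real m + 1) powr \<bar>\<alpha>\<bar> * (real k + 1) powr \<alpha>) * ((real n + 1) powr \<bar>\<alpha>\<bar> * (real l + 1) powr \<alpha>)"
        by (intro mult_mono powr_index_shift_le) auto
      then have "?w (k + m) (l + n) * (cmod (a k l))\<^sup>2 \<le>
          ((real m + 1) powr \<bar>\<alpha>\<bar> * (real k + 1) powr \<alpha>) * ((real n + 1) powr \<bar>\<alpha>\<bar> * (real l + 1) powr \<alpha>)
            * (cmod (a k l))\<^sup>2"
        by (rule mult_right_mono) simp
      then show "(?g \<circ> h) p \<le> ?K * (case p of (k, l) \<Rightarrow> ?w k l * (cmod (a k l))\<^sup>2)"
        by (simp add: p h_def b_def mult_ac)
    qed (auto simp: h_def)
    then have "?g summable_on (range h)"
      by (simp only: summable_on_reindex[OF inj])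
    then show "?g summable_on UNIV"
      by (subst summable_on_cong_neutral[where T = "range h"]) (auto simp: case_prod_unfold b0)
  qed
qed

lemma span_subset_bidisk_space:
  assumes "B \<subseteq> bidisk_space \<alpha>"
  shows "cfun.span B \<subseteq> bidisk_space \<alpha>"
proof (rule cfun.span_minimal[OF assms])
  have "bidisk_expansion 0 (\<lambda>_ _. 0)"
    by (simp add: bidisk_expansion_def case_prod_unfold)
  then have "0 \<in> bidisk_space \<alpha>"
    by (rule bidisk_spaceI) (simp add: case_prod_unfold)
  then show "cfun.subspace (bidisk_space \<alpha>)"
    by (intro cfun.subspaceI bidisk_space_add bidisk_space_scale)
qed

text \<open>Precomposition is linear, so checking generators suffices. It is used with \<sigma> the
  exchange of coordinates and with \<sigma> the embedding of z as (z, w).\<close>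

lemma span_compose:
  assumes "h \<in> cfun.span B" and "\<And>b. b \<in> B \<Longrightarrow> (\<lambda>x. b (\<sigma> x)) \<in> cfun.span B'"
  shows "(\<lambda>x. h (\<sigma> x)) \<in> cfun.span B'"
  using assms(1)
proof (induction rule: cfun.span_induct_alt)
  case base
  have "(\<lambda>x. 0) \<in> cfun.span B'"
    using cfun.span_zero[of B'] by (simp add: zero_fun_def)
  then show ?case by simp
next
  case (step c b g)
  have "(\<lambda>x. c * b (\<sigma> x)) + (\<lambda>x. g (\<sigma> x)) \<in> cfun.span B'"
    by (intro cfun.span_add cfun.span_scale assms(2) step)
  then show ?case by (simp add: plus_fun_def)
qed

section \<open>Exchanging the variables and approximation by multiples of f\<close>

text \<open>The weight is symmetric in k and l, so transposing the coefficient array changes no sum.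
  This symmetry reduces the slices in one variable to those in the other.\<close>

lemma bidisk_space_swap:
  assumes "u \<in> bidisk_space \<alpha>"
  shows "(\<lambda>x. u (prod.swap x)) \<in> bidisk_space \<alpha>"
    and "bidisk_norm \<alpha> (\<lambda>x. u (prod.swap x)) = bidisk_norm \<alpha> u"
proof -
  let ?w = "\<lambda>k l. (real k + 1) powr \<alpha> * (real l + 1) powr \<alpha>"
  obtain a where a: "bidisk_expansion u a" "(\<lambda>(k, l). ?w k l * (cmod (a k l))\<^sup>2) summable_on UNIV"
    "bidisk_norm \<alpha> u = sqrt (\<Sum>\<^sub>\<infinity>(k, l). ?w k l * (cmod (a k l))\<^sup>2)"
    using assms by (rule bidisk_spaceE)
  have bij: "bij_betw prod.swap (UNIV :: (nat \<times> nat) set) UNIV" by simp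
  have exp: "bidisk_expansion (\<lambda>x. u (prod.swap x)) (\<lambda>k l. a l k)"
    unfolding bidisk_expansion_def
  proof (intro ballI)
    fix z1 z2 :: complex assume "z1 \<in> unit_disk" "z2 \<in> unit_disk"
    then have "((\<lambda>(k, l). a k l * z2 ^ k * z1 ^ l) has_sum u (z2, z1)) UNIV"
      using a(1) unfolding bidisk_expansion_def by blast
    then show "((\<lambda>(k, l). a l k * z1 ^ k * z2 ^ l) has_sum u (prod.swap (z1, z2))) UNIV"
      by (subst (asm) has_sum_reindex_bij_betw[OF bij, symmetric])
        (simp add: case_prod_unfold mult_ac)
  qed
  have "(\<lambda>(k, l). ?w k l * (cmod (a l k))\<^sup>2) summable_on UNIV"
    using a(2) by (subst (asm) summable_on_reindex_bij_betw[OF bij, symmetric])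
      (simp add: case_prod_unfold mult_ac)
  with exp show "(\<lambda>x. u (prod.swap x)) \<in> bidisk_space \<alpha>" by (rule bidisk_spaceI)
  have "(\<Sum>\<^sub>\<infinity>(k, l). ?w k l * (cmod (a l k))\<^sup>2) = (\<Sum>\<^sub>\<infinity>(k, l). ?w k l * (cmod (a k l))\<^sup>2)"
    by (subst (2) infsum_reindex_bij_betw[OF bij, symmetric]) (simp add: case_prod_unfold mult_ac)
  then show "bidisk_norm \<alpha> (\<lambda>x. u (prod.swap x)) = bidisk_norm \<alpha> u"
    by (simp add: bidisk_norm_def bicoeff_eqI[OF exp] bicoeff_eqI[OF a(1)])
qed

lemma bidisk_cyclic_subset:
  assumes "bidisk_cyclic \<alpha> f"
  shows "cfun.span (range (\<lambda>(k, l) (z1, z2). z1 ^ k * z2 ^ l * f (z1, z2))) \<subseteq> bidisk_space \<alpha>"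
  using assms unfolding bidisk_cyclic_def
  by (intro span_subset_bidisk_space) (auto intro: bidisk_space_mult_monomial)

lemma bidisk_space_diff:
  assumes "u \<in> bidisk_space \<alpha>" "v \<in> bidisk_space \<alpha>"
  shows "(\<lambda>x. u x - v x) \<in> bidisk_space \<alpha>"
  using bidisk_space_add[OF assms(1) bidisk_space_scale[OF assms(2), of "-1"]]
  by (simp add: plus_fun_def)

text \<open>\<open>closed_span\<close> only records that the error is small in norm. Its membership
  in the space is added here because both the exchange isometry and the slice bound apply to members
  only.\<close>

lemma bidisk_cyclic_approx:
  assumes "bidisk_cyclic \<alpha> f" "u \<in> bidisk_space \<alpha>" "0 < \<epsilon>"
  obtains h where "h \<in> cfun.span (range (\<lambda>(k, l) (z1, z2). z1 ^ k * z2 ^ l * f (z1, z2)))"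
    and "(\<lambda>x. u x - h x) \<in> bidisk_space \<alpha>" and "bidisk_norm \<alpha> (\<lambda>x. u x - h x) < \<epsilon>"
proof -
  have "u \<in> closed_span (bidisk_space \<alpha>) (bidisk_norm \<alpha>)
       (range (\<lambda>(k, l) (z1, z2). z1 ^ k * z2 ^ l * f (z1, z2)))"
    using assms by (simp add: bidisk_cyclic_def)
  then obtain h where h: "h \<in> cfun.span (range (\<lambda>(k, l) (z1, z2). z1 ^ k * z2 ^ l * f (z1, z2)))"
    "bidisk_norm \<alpha> (\<lambda>x. u x - h x) < \<epsilon>"
    using assms(3) unfolding closed_span_def by blast
  moreover have "(\<lambda>x. u x - h x) \<in> bidisk_space \<alpha>"
    using h(1) bidisk_cyclic_subset[OF assms(1)] assms(2) by (intro bidisk_space_diff) auto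
  ultimately show ?thesis using that by blast
qed

text \<open>The exchange is an isometric involution that turns the generator with exponents (k, l)
  for f into the one with exponents (l, k) for the exchanged function. So one approximates the
  exchanged u by multiples of f and exchanges back.\<close>

lemma bidisk_cyclic_swap:
  assumes cyc: "bidisk_cyclic \<alpha> f"
  shows "bidisk_cyclic \<alpha> (\<lambda>x. f (prod.swap x))"
proof -
  let ?B = "\<lambda>f. range (\<lambda>(k, l) (z1, z2). z1 ^ k * z2 ^ l * f (z1, z2 :: complex)) :: (complex \<times> complex \<Rightarrow> complex) set"
  let ?f = "\<lambda>x. f (prod.swap x)"
  have "u \<in> closed_span (bidisk_space \<alpha>) (bidisk_norm \<alpha>) (?B ?f)" if u: "u \<in> bidisk_space \<alpha>" for u
    unfolding closed_span_def
  proof (intro CollectI conjI allI impI u)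
    fix \<epsilon> :: real assume "0 < \<epsilon>"
    from bidisk_cyclic_approx[OF cyc bidisk_space_swap(1)[OF u] this]
    obtain h where h: "h \<in> cfun.span (?B f)" "(\<lambda>x. u (prod.swap x) - h x) \<in> bidisk_space \<alpha>"
      "bidisk_norm \<alpha> (\<lambda>x. u (prod.swap x) - h x) < \<epsilon>"
      by blast
    have "(\<lambda>x. h (prod.swap x)) \<in> cfun.span (?B ?f)"
    proof (rule span_compose[OF h(1)])
      fix b assume "b \<in> ?B f"
      then obtain k l where b: "b = (\<lambda>(z1, z2). z1 ^ k * z2 ^ l * f (z1, z2))" by auto
      have "(\<lambda>x. b (prod.swap x)) = (\<lambda>(k, l) (z1, z2). z1 ^ k * z2 ^ l * ?f (z1, z2)) (l, k)"
        by (auto simp: b fun_eq_iff)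
      then show "(\<lambda>x. b (prod.swap x)) \<in> cfun.span (?B ?f)"
        by (simp only: cfun.span_base rangeI)
    qed
    moreover have "bidisk_norm \<alpha> (\<lambda>x. u x - h (prod.swap x)) < \<epsilon>"
      using bidisk_space_swap(2)[OF h(2)] h(3) by simp
    ultimately show "\<exists>h\<in>cfun.span (?B ?f). bidisk_norm \<alpha> (\<lambda>x. u x - h x) < \<epsilon>"
      by (intro bexI[of _ "\<lambda>x. h (prod.swap x)"])
  qed
  moreover have "closed_span (bidisk_space \<alpha>) (bidisk_norm \<alpha>) (?B ?f) \<subseteq> bidisk_space \<alpha>"
    by (auto simp: closed_span_def)
  moreover have "?f \<in> bidisk_space \<alpha>"
    using cyc bidisk_space_swap(1) by (auto simp: bidisk_cyclic_def)
  ultimately show ?thesis unfolding bidisk_cyclic_def by blast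
qed

section \<open>The slice map and its boundedness\<close>

lemma summable_on_imp_has_sum_suminf:
  fixes f :: "nat \<Rightarrow> 'a::banach"
  assumes "f summable_on UNIV"
  shows "(f has_sum suminf f) UNIV"
  using has_sum_infsum[OF assms] sums_unique[OF has_sum_imp_sums[OF has_sum_infsum[OF assms]]]
  by simp

text \<open>An unconditional double sum may be grouped by the exponent k of \<open>z1\<close>; the
  inner sums then are the coefficients of the slice.\<close>

lemma bidisk_slice_sums:
  assumes a: "bidisk_expansion u a" and z: "z1 \<in> unit_disk" "z2 \<in> unit_disk"
  shows "summable (\<lambda>l. a k l * z2 ^ l)"
    and "(\<lambda>k. (\<Sum>l. a k l * z2 ^ l) * z1 ^ k) sums u (z1, z2)"
proof -
  have d: "((\<lambda>(k, l). a k l * z1 ^ k * z2 ^ l) has_sum u (z1, z2)) (UNIV \<times> UNIV)"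
    if "z1 \<in> unit_disk" for z1
    using a z that by (simp add: bidisk_expansion_def)
  \<comment> \<open>The first variable is set to 1/2 because it is nonzero: the factor (1/2)^k can
    be divided out of the k-th row, which would fail at \<open>z1\<close> = 0.\<close>
  have inner: "(\<lambda>l. a k l * z2 ^ l) summable_on UNIV" for k
  proof -
    have "(\<lambda>(k, l). a k l * (1/2) ^ k * z2 ^ l) summable_on (UNIV \<times> UNIV)"
      using d[of "1/2"] by (auto simp: summable_on_def)
    then have "(\<lambda>l. a k l * (1/2) ^ k * z2 ^ l) summable_on UNIV"
      using summable_on_SigmaD1[of "\<lambda>k l. a k l * (1/2) ^ k * z2 ^ l" UNIV "\<lambda>_. UNIV" k] by simp
    then have "(\<lambda>l. 2 ^ k * (a k l * (1/2) ^ k * z2 ^ l)) summable_on UNIV"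
      by (rule summable_on_cmult_right)
    then show ?thesis by (simp add: field_simps)
  qed
  then show "summable (\<lambda>l. a k l * z2 ^ l)" by (rule summable_on_imp_summable)
  have S: "((\<lambda>l. a k l * z2 ^ l) has_sum (\<Sum>l. a k l * z2 ^ l)) UNIV" for k
    using inner[of k] by (rule summable_on_imp_has_sum_suminf)
  have "((\<lambda>l. a k l * z1 ^ k * z2 ^ l) has_sum ((\<Sum>l. a k l * z2 ^ l) * z1 ^ k)) UNIV" for k
    using has_sum_cmult_left[OF S[of k], of "z1 ^ k"] by (simp add: mult_ac)
  then have "((\<lambda>k. (\<Sum>l. a k l * z2 ^ l) * z1 ^ k) has_sum u (z1, z2)) UNIV"
    using has_sum_SigmaD[OF d[OF z(1)], of "\<lambda>k. (\<Sum>l. a k l * z2 ^ l) * z1 ^ k"] by simp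
  then show "(\<lambda>k. (\<Sum>l. a k l * z2 ^ l) * z1 ^ k) sums u (z1, z2)" by (rule has_sum_imp_sums)
qed

text \<open>Finite Cauchy-Schwarz bounds every partial sum; the right-hand partial sums have
  nonnegative terms and stay below the full series, so the bound survives the limit.\<close>

lemma norm_suminf_squared_le_weighted:
  fixes c d :: "nat \<Rightarrow> complex" and p :: "nat \<Rightarrow> real"
  assumes "\<And>l. 0 < p l" and sum: "summable (\<lambda>l. c l * d l)"
    and c: "summable (\<lambda>l. p l * (cmod (c l))\<^sup>2)" and d: "summable (\<lambda>l. (cmod (d l))\<^sup>2 / p l)"
  shows "(cmod (\<Sum>l. c l * d l))\<^sup>2 \<le> (\<Sum>l. p l * (cmod (c l))\<^sup>2) * (\<Sum>l. (cmod (d l))\<^sup>2 / p l)"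
proof (rule LIMSEQ_le_const2)
  show "(\<lambda>n. (cmod (\<Sum>l<n. c l * d l))\<^sup>2) \<longlonglongrightarrow> (cmod (\<Sum>l. c l * d l))\<^sup>2"
    by (intro tendsto_power tendsto_norm summable_LIMSEQ sum)
  have p: "0 \<le> p l" for l using assms(1) less_imp_le by blast
  have "(cmod (\<Sum>l<n. c l * d l))\<^sup>2 \<le> (\<Sum>l. p l * (cmod (c l))\<^sup>2) * (\<Sum>l. (cmod (d l))\<^sup>2 / p l)" for n
  proof -
    have "cmod (\<Sum>l<n. c l * d l) \<le> (\<Sum>l<n. cmod (c l) * cmod (d l))"
      by (rule order_trans[OF norm_sum]) (simp add: norm_mult)
    \<comment> \<open>The weight is inserted as sqrt(p l) in one factor and its inverse in the
      other.\<close>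
    also have "\<dots> = (\<Sum>l<n. (sqrt (p l) * cmod (c l)) * (cmod (d l) / sqrt (p l)))"
      using assms(1) by (intro sum.cong) (auto simp: less_imp_neq[symmetric])
    finally have "(cmod (\<Sum>l<n. c l * d l))\<^sup>2 \<le> (\<Sum>l<n. (sqrt (p l) * cmod (c l)) * (cmod (d l) / sqrt (p l)))\<^sup>2"
      by (rule power_mono) simp
    also have "\<dots> \<le> (\<Sum>l<n. (sqrt (p l) * cmod (c l))\<^sup>2) * (\<Sum>l<n. (cmod (d l) / sqrt (p l))\<^sup>2)"
      by (rule Cauchy_Schwarz_ineq_sum)
    also have "\<dots> = (\<Sum>l<n. p l * (cmod (c l))\<^sup>2) * (\<Sum>l<n. (cmod (d l))\<^sup>2 / p l)"
      using p by (simp add: power_mult_distrib power_divide)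
    also have "\<dots> \<le> (\<Sum>l. p l * (cmod (c l))\<^sup>2) * (\<Sum>l. (cmod (d l))\<^sup>2 / p l)"
      using p by (intro mult_mono sum_le_suminf c d sum_nonneg suminf_nonneg) auto
    finally show ?thesis .
  qed
  then show "\<exists>N. \<forall>n\<ge>N. (cmod (\<Sum>l<n. c l * d l))\<^sup>2 \<le> (\<Sum>l. p l * (cmod (c l))\<^sup>2) * (\<Sum>l. (cmod (d l))\<^sup>2 / p l)"
    by blast
qed

text \<open>The constant is fixed before u, depending only on w and \<alpha>; this uniformity lets
  approximations pass to slices.\<close>

lemma bidisk_slice_bounded:
  assumes w: "w \<in> unit_disk"
  obtains C where "0 \<le> C"
    and "\<And>u. u \<in> bidisk_space \<alpha> \<Longrightarrow>
      (\<lambda>z. u (z, w)) \<in> D_space \<alpha> \<and> D_norm \<alpha> (\<lambda>z. u (z, w)) \<le> C * bidisk_norm \<alpha> u"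
proof -
  \<comment> \<open>The dual-weight sum of the powers of w, finite since |w| < 1 beats any power of
    l + 1.\<close>
  define K where "K = (\<Sum>l. (cmod (w ^ l))\<^sup>2 / (real l + 1) powr \<alpha>)"
  have "((cmod w)\<^sup>2) < 1" using w by (simp add: power_less_one_iff abs_square_less_1)
  then have "summable (\<lambda>l. (real l + 1) powr (- \<alpha>) * ((cmod w)\<^sup>2) ^ l)"
    by (intro summable_powr_mult_power) auto
  then have K: "summable (\<lambda>l. (cmod (w ^ l))\<^sup>2 / (real l + 1) powr \<alpha>)"
    by (simp add: powr_minus norm_power power_mult[symmetric] mult.commute divide_inverse)
  have K0: "0 \<le> K" unfolding K_def by (intro suminf_nonneg K) auto
  have "(\<lambda>z. u (z, w)) \<in> D_space \<alpha> \<and> D_norm \<alpha> (\<lambda>z. u (z, w)) \<le> sqrt K * bidisk_norm \<alpha> u"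
    if "u \<in> bidisk_space \<alpha>" for u
  proof -
    let ?w = "\<lambda>k l. (real k + 1) powr \<alpha> * (real l + 1) powr \<alpha>"
    from that obtain a where a: "bidisk_expansion u a"
      "(\<lambda>(k, l). ?w k l * (cmod (a k l))\<^sup>2) summable_on UNIV"
      "bidisk_norm \<alpha> u = sqrt (\<Sum>\<^sub>\<infinity>(k, l). ?w k l * (cmod (a k l))\<^sup>2)"
      by (rule bidisk_spaceE)
    define b where "b = (\<lambda>k. \<Sum>l. a k l * w ^ l)"
    \<comment> \<open>The squared weighted norm of the k-th row of coefficients.\<close>
    define R where "R = (\<lambda>k. \<Sum>l. (real l + 1) powr \<alpha> * (cmod (a k l))\<^sup>2)"
    have slice: "(\<lambda>k. b k * z ^ k) sums u (z, w)" if "z \<in> unit_disk" for z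
      unfolding b_def using bidisk_slice_sums(2)[OF a(1) that w] .
    have row_on: "(\<lambda>l. (real l + 1) powr \<alpha> * (cmod (a k l))\<^sup>2) summable_on UNIV" for k
    proof -
      have "(\<lambda>l. ?w k l * (cmod (a k l))\<^sup>2) summable_on UNIV"
        using summable_on_SigmaD1[of "\<lambda>k l. ?w k l * (cmod (a k l))\<^sup>2" UNIV "\<lambda>_. UNIV" k] a(2) by simp
      from summable_on_cmult_right[OF this, of "1 / (real k + 1) powr \<alpha>"]
      show ?thesis by (simp add: mult.assoc)
    qed
    have R: "((\<lambda>l. (real l + 1) powr \<alpha> * (cmod (a k l))\<^sup>2) has_sum R k) UNIV" for k
      unfolding R_def using row_on[of k] by (rule summable_on_imp_has_sum_suminf)
    have b_le: "(cmod (b k))\<^sup>2 \<le> R k * K" for k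
      unfolding b_def R_def K_def
      by (rule norm_suminf_squared_le_weighted)
        (use bidisk_slice_sums(1)[OF a(1) w w] summable_on_imp_summable[OF row_on] K in auto)
    \<comment> \<open>Summing the double series row by row recovers the squared bidisk norm.\<close>
    have "((\<lambda>k. (real k + 1) powr \<alpha> * R k) has_sum (bidisk_norm \<alpha> u)\<^sup>2) UNIV"
    proof (rule has_sum_SigmaD)
      show "((\<lambda>(k, l). ?w k l * (cmod (a k l))\<^sup>2) has_sum (bidisk_norm \<alpha> u)\<^sup>2) (UNIV \<times> UNIV)"
        using has_sum_infsum[OF a(2)] by (simp add: a(3) infsum_nonneg case_prod_unfold)
      show "((\<lambda>l. case (k, l) of (k, l) \<Rightarrow> ?w k l * (cmod (a k l))\<^sup>2) has_sum
          (real k + 1) powr \<alpha> * R k) UNIV" for k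
        using has_sum_cmult_right[OF R[of k], of "(real k + 1) powr \<alpha>"] by (simp add: mult.assoc)
    qed
    then have total: "(\<lambda>k. K * ((real k + 1) powr \<alpha> * R k)) sums (K * (bidisk_norm \<alpha> u)\<^sup>2)"
      by (intro sums_mult has_sum_imp_sums)
    have term_le: "(real k + 1) powr \<alpha> * (cmod (b k))\<^sup>2 \<le> K * ((real k + 1) powr \<alpha> * R k)" for k
      using mult_left_mono[OF b_le[of k], of "(real k + 1) powr \<alpha>"] by (simp add: mult_ac)
    have smb: "summable (\<lambda>k. (real k + 1) powr \<alpha> * (cmod (b k))\<^sup>2)"
      by (rule summable_comparison_test'[OF sums_summable[OF total], of 0]) (use term_le in auto)
    have hol: "(\<lambda>z. u (z, w)) holomorphic_on unit_disk"
      using slice by (rule sums_disk_imp_fps_expansion(1))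
    have exp: "fps_nth (fps_expansion (\<lambda>z. u (z, w)) 0) = b"
      using slice by (rule sums_disk_imp_fps_expansion(2))
    have "(\<lambda>z. u (z, w)) \<in> D_space \<alpha>"
      using smb by (simp add: D_space_def hol exp)
    moreover have "(\<Sum>k. (real k + 1) powr \<alpha> * (cmod (b k))\<^sup>2) \<le> K * (bidisk_norm \<alpha> u)\<^sup>2"
      using suminf_le[OF term_le smb sums_summable[OF total]] sums_unique[OF total] by simp
    then have "D_norm \<alpha> (\<lambda>z. u (z, w)) \<le> sqrt (K * (bidisk_norm \<alpha> u)\<^sup>2)"
      by (simp add: D_norm_def exp)
    moreover have "0 \<le> bidisk_norm \<alpha> u" by (simp add: a(3) infsum_nonneg case_prod_unfold)
    ultimately show ?thesis by (simp add: real_sqrt_mult)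
  qed
  then show ?thesis using K0 by (intro that[of "sqrt K"]) auto
qed

section \<open>From cyclicity on the bidisk to cyclicity of slices\<close>

text \<open>The array lives on l = 0, where the second weight equals 1, so the double sums reduce to
  those of g. Slicing at any w returns g.\<close>

lemma bidisk_space_extension:
  assumes "g \<in> D_space \<alpha>"
  shows "(\<lambda>(z1, z2). g z1) \<in> bidisk_space \<alpha>"
proof -
  define c where "c = fps_nth (fps_expansion g 0)"
  define a where "a = (\<lambda>k l :: nat. if l = 0 then c k else 0)"
  have inj: "inj (\<lambda>k::nat. (k, 0::nat))" by (simp add: inj_on_def)
  have hol: "g holomorphic_on unit_disk"
    and sm: "summable (\<lambda>k. (real k + 1) powr \<alpha> * (cmod (c k))\<^sup>2)"
    using assms by (auto simp: D_space_def c_def)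
  show ?thesis
  proof (rule bidisk_spaceI)
    show "bidisk_expansion (\<lambda>(z1, z2). g z1) a"
      unfolding bidisk_expansion_def
    proof (intro ballI)
      fix z1 z2 :: complex assume "z1 \<in> unit_disk"
      then have "((\<lambda>k. c k * z1 ^ k) has_sum g z1) UNIV"
        unfolding c_def by (rule holomorphic_disk_has_sum[OF hol])
      also have "(\<lambda>k. c k * z1 ^ k) = (\<lambda>(k, l). a k l * z1 ^ k * z2 ^ l) \<circ> (\<lambda>k. (k, 0))"
        by (simp add: a_def fun_eq_iff)
      finally have "((\<lambda>(k, l). a k l * z1 ^ k * z2 ^ l) has_sum g z1) (range (\<lambda>k. (k, 0)))"
        by (simp only: has_sum_reindex[OF inj])
      then have "((\<lambda>(k, l). a k l * z1 ^ k * z2 ^ l) has_sum g z1) UNIV"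
        by (subst has_sum_cong_neutral[where T = "range (\<lambda>k. (k, 0))"]) (auto simp: a_def)
      then show "((\<lambda>(k, l). a k l * z1 ^ k * z2 ^ l) has_sum (\<lambda>(z1, z2). g z1) (z1, z2)) UNIV"
        by simp
    qed
    let ?g = "\<lambda>(k, l). (real k + 1) powr \<alpha> * (real l + 1) powr \<alpha> * (cmod (a k l))\<^sup>2"
    have "(\<lambda>k. (real k + 1) powr \<alpha> * (cmod (c k))\<^sup>2) summable_on UNIV"
      using sm by (intro summable_nonneg_imp_summable_on) auto
    also have "(\<lambda>k. (real k + 1) powr \<alpha> * (cmod (c k))\<^sup>2) = ?g \<circ> (\<lambda>k. (k, 0))"
      by (simp add: a_def fun_eq_iff)
    finally have "?g summable_on (range (\<lambda>k. (k, 0)))"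
      by (simp only: summable_on_reindex[OF inj])
    then show "?g summable_on UNIV"
      by (subst summable_on_cong_neutral[where T = "range (\<lambda>k. (k, 0))"]) (auto simp: a_def)
  qed
qed

lemma bidisk_cyclic_imp_slice_cyclic:
  assumes cyc: "bidisk_cyclic \<alpha> f" and w: "w \<in> unit_disk"
  shows "D_cyclic \<alpha> (\<lambda>z. f (z, w))"
proof -
  let ?B = "range (\<lambda>k z. z ^ k * f (z, w))"
  obtain C where C: "0 \<le> C" "\<And>u. u \<in> bidisk_space \<alpha> \<Longrightarrow>
      (\<lambda>z. u (z, w)) \<in> D_space \<alpha> \<and> D_norm \<alpha> (\<lambda>z. u (z, w)) \<le> C * bidisk_norm \<alpha> u"
    using bidisk_slice_bounded[OF w, of \<alpha>] by blast
  have "g \<in> closed_span (D_space \<alpha>) (D_norm \<alpha>) ?B" if g: "g \<in> D_space \<alpha>" for g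
    unfolding closed_span_def
  proof (intro CollectI conjI allI impI g)
    fix \<epsilon> :: real assume \<epsilon>: "0 < \<epsilon>"
    \<comment> \<open>Dividing by C + 1 allows C = 0 and leaves C * \<delta> strictly below
      \<epsilon>.\<close>
    define \<delta> where "\<delta> = \<epsilon> / (C + 1)"
    have "0 < \<delta>" using \<epsilon> C(1) by (simp add: \<delta>_def)
    from bidisk_cyclic_approx[OF cyc bidisk_space_extension[OF g] this]
    obtain h where h: "h \<in> cfun.span (range (\<lambda>(k, l) (z1, z2). z1 ^ k * z2 ^ l * f (z1, z2)))"
      and mem: "(\<lambda>x. (\<lambda>(z1, z2). g z1) x - h x) \<in> bidisk_space \<alpha>"
      and less: "bidisk_norm \<alpha> (\<lambda>x. (\<lambda>(z1, z2). g z1) x - h x) < \<delta>"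
      by blast
    have "(\<lambda>z. h (z, w)) \<in> cfun.span ?B"
    proof (rule span_compose[OF h])
      fix b assume "b \<in> range (\<lambda>(k, l) (z1, z2). z1 ^ k * z2 ^ l * f (z1, z2))"
      then obtain k l where b: "b = (\<lambda>(z1, z2). z1 ^ k * z2 ^ l * f (z1, z2))" by auto
      \<comment> \<open>On the slice the power of the second variable is the scalar w^l, so the
        generator becomes a multiple of the k-th generator for the slice.\<close>
      have "(\<lambda>z. w ^ l * (z ^ k * f (z, w))) \<in> cfun.span ?B"
        by (intro cfun.span_scale cfun.span_base) auto
      then show "(\<lambda>z. b (z, w)) \<in> cfun.span ?B" by (simp add: b mult_ac)
    qed
    moreover have "D_norm \<alpha> (\<lambda>z. g z - h (z, w)) < \<epsilon>"
    proof -
      have "D_norm \<alpha> (\<lambda>z. g z - h (z, w)) \<le> C * bidisk_norm \<alpha> (\<lambda>x. (\<lambda>(z1, z2). g z1) x - h x)"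
        using C(2)[OF mem] by simp
      also have "\<dots> \<le> C * \<delta>" using less C(1) by (intro mult_left_mono) auto
      also have "\<dots> < \<epsilon>" using \<epsilon> C(1) by (simp add: \<delta>_def field_simps)
      finally show ?thesis .
    qed
    ultimately show "\<exists>h\<in>cfun.span ?B. D_norm \<alpha> (\<lambda>x. g x - h x) < \<epsilon>"
      by (intro bexI[of _ "\<lambda>z. h (z, w)"])
  qed
  moreover have "closed_span (D_space \<alpha>) (D_norm \<alpha>) ?B \<subseteq> D_space \<alpha>"
    by (auto simp: closed_span_def)
  moreover have "(\<lambda>z. f (z, w)) \<in> D_space \<alpha>"
    using C(2) cyc by (simp add: bidisk_cyclic_def)
  ultimately show ?thesis unfolding D_cyclic_def by blast
qed

theorem proposition2p1:
  fixes \<alpha> :: real and f :: "complex \<times> complex \<Rightarrow> complex"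
  assumes "bidisk_cyclic \<alpha> f"
  shows "(\<forall>z2\<in>unit_disk. D_cyclic \<alpha> (\<lambda>z1. f (z1, z2))) \<and>
         (\<forall>z1\<in>unit_disk. D_cyclic \<alpha> (\<lambda>z2. f (z1, z2)))"
  \<comment> \<open>Fixing the second variable of the exchanged function fixes the first variable of
    f, which yields the other half.\<close>
  using bidisk_cyclic_imp_slice_cyclic[OF assms]
    bidisk_cyclic_imp_slice_cyclic[OF bidisk_cyclic_swap[OF assms]] by simp

end
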